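(* Let $P=P_1\cdots P_\kappa$ be a product of linear forms as in the context, in the variables $x_1,\dots,x_r$, and let $\alpha=\max_{Q\in S_P}\frac{r-r(Q)}{\kappa-\kappa(Q)}$. Suppose $s\in\mathbb{R}$ and $s<\alpha$. Then the series $$\zeta(P;s)=\sum_{x_1,\dots,x_r=1}^{\infty}P(x_1,\dots,x_r)^{-s}$$ diverges.
   Context: Let $r,\kappa\ge 1$. $P=P_1\cdots P_\kappa$ where each $P_i=a_{i1}x_1+a_{i2}x_2+\cdots+a_{ir}x_r$ is a linear polynomial over $\mathbb{R}$ with all $a_{ij}\ge 0$ and, for each $i$, at least one $a_{ij}>0$. It is assumed that each variable $x_j$ occurs with non-zero coefficient in at least one factor $P_i$. For a subset of variables $\{x_{j_1},\dots,x_{j_l}\}$, the subpolynomial $Q=P[j_1,\dots,j_l]$ is the product of those linear factors $P_i$ of $P$ which contain only the variables $x_{j_1},\dots,x_{j_l}$ with a non-zero coefficient. One writes $r(Q)=l$ for the number of variables, and $\kappa(Q)$ for the number of linear factors in $Q$. $S_P$ is the set of all proper subpolynomials of $P$ (those given by proper subsets of the set of variables), including the empty subpolynomial $1$ with no variables and degree $0$ (so $r(1)=\kappa(1)=0$). *)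

theory Defs
  imports "HOL-Analysis.Infinite_Sum" "HOL-Library.FuncSet"
begin

text \<open>
  A product of linear forms, given by the index set of its variables, the index set of its
  factors, and its coefficients: \<open>coeff P i j\<close> is the coefficient of the variable \<open>x\<^sub>j\<close> in the
  factor \<open>P\<^sub>i\<close>. Factors are indexed, so a repeated factor counts with multiplicity.
\<close>

datatype linear_product =
  Linear_Product (vars: "nat set") (factors: "nat set") (coeff: "nat \<Rightarrow> nat \<Rightarrow> real")

definition eval_poly :: "linear_product \<Rightarrow> (nat \<Rightarrow> real) \<Rightarrow> real" where
  "eval_poly P x = (\<Prod>i\<in>factors P. \<Sum>j\<in>vars P. coeff P i j * x j)"

definition num_vars :: "linear_product \<Rightarrow> nat" where
  "num_vars P = card (vars P)"

definition num_factors :: "linear_product \<Rightarrow> nat" where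
  "num_factors P = card (factors P)"

definition subpoly :: "linear_product \<Rightarrow> nat set \<Rightarrow> linear_product" where
  "subpoly P J =
     Linear_Product J {i \<in> factors P. \<forall>j\<in>vars P. coeff P i j \<noteq> 0 \<longrightarrow> j \<in> J} (coeff P)"

text \<open>
  A subpolynomial remembers the set of variables defining it, so \<open>num_vars (subpoly P J) = card J\<close>
  even if some variable in \<open>J\<close> occurs in none of its factors.
\<close>

definition proper_subpolys :: "linear_product \<Rightarrow> linear_product set" where
  "proper_subpolys P = {subpoly P J |J. J \<subset> vars P}"

definition alpha :: "linear_product \<Rightarrow> real" where
  "alpha P = Max ((\<lambda>Q. (real (num_vars P) - real (num_vars Q)) /
                       (real (num_factors P) - real (num_factors Q))) ` proper_subpolys P)"

text \<open>
  For the products considered, all terms of the series are positive, so its convergence does not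
  depend on the order of summation and is the same as unconditional summability.
\<close>

definition zeta_converges :: "linear_product \<Rightarrow> real \<Rightarrow> bool" where
  "zeta_converges P s \<longleftrightarrow>
     (\<lambda>x. eval_poly P (\<lambda>j. real (x j)) powr (- s)) summable_on (vars P \<rightarrow>\<^sub>E {1::nat..})"

end

theory Submission
  imports Defs
begin

text \<open>
  Let the maximum \<open>\<alpha> = l / m\<close> be attained at the subpolynomial of a proper set \<open>J\<close> of variables, where
  \<open>l > 0\<close> variables lie outside \<open>J\<close> and \<open>m > 0\<close> factors involve at least one of them. The series
  already diverges over the points with \<open>x\<^sub>j = 1\<close> for \<open>j \<in> J\<close>. Write \<open>C = P(1, \<dots>, 1) > 0\<close>. If in
  addition \<open>x\<^sub>j \<le> N\<close> for all \<open>j \<notin> J\<close>, then the factors over \<open>J\<close> keep their value at \<open>(1, \<dots>, 1)\<close> and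
  the other \<open>m\<close> factors grow at most by the factor \<open>N\<close>, so \<open>C \<le> P(x) \<le> C N\<^sup>m\<close>
  (\<open>eval_poly_ge_eval_ones\<close>, \<open>eval_poly_le_on_box\<close>). Hence
  \<open>P(x)\<^sup>-\<^sup>s \<ge> C\<^sup>-\<^sup>s N\<^sup>-\<^sup>m\<^sup>t\<close> with \<open>t = max s 0\<close>: the upper bound on \<open>P(x)\<close> gives this for \<open>s \<ge> 0\<close>, the
  lower bound for \<open>s < 0\<close>. There are \<open>N\<^sup>l\<close> such points, and their contribution is at
  least \<open>C\<^sup>-\<^sup>s N\<^sup>l\<^sup>-\<^sup>m\<^sup>t\<close>, which is unbounded because \<open>t < l / m\<close> (\<open>not_summable_on_boxes\<close>).
\<close>

lemma not_bounded_powr: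
  fixes D T e :: real
  assumes "D > 0" "e > 0"
  shows "\<exists>N::nat. N \<ge> 1 \<and> D * real N powr e > T"
proof -
  define y where "y = \<bar>T\<bar> / D + 1"
  have "D * y = \<bar>T\<bar> + D"
    using assms by (simp add: y_def distrib_left)
  then have y: "y \<ge> 1" "D * y > T"
    using assms by (auto simp: y_def)
  obtain N :: nat where N: "real N \<ge> y powr (1 / e)"
    using real_arch_simple by blast
  have "y = (y powr (1 / e)) powr e"
    using y assms by (simp add: powr_powr)
  also have "\<dots> \<le> real N powr e"
    using N assms by (intro powr_mono2) auto
  finally have "y \<le> real N powr e" .
  then have "D * real N powr e > T"
    using y(2) assms(1) by (smt (verit) mult_left_mono)
  moreover have "N \<ge> 1"
    using \<open>y \<le> real N powr e\<close> y(1) by (cases "N = 0") auto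
  ultimately show ?thesis by blast
qed

text \<open>
  A nonnegative function that is at least \<open>D N\<^sup>-\<^sup>b\<close> on some \<open>N\<^sup>l\<close> points, for every \<open>N \<ge> 1\<close>, where
  \<open>D > 0\<close> and \<open>b < l\<close>, has unbounded finite partial sums.
\<close>

lemma not_summable_on_boxes:
  fixes f :: "'a \<Rightarrow> real" and D b :: real
  assumes "\<And>x. x \<in> A \<Longrightarrow> f x \<ge> 0"
    and "D > 0" and "b < real l"
    and "\<And>N. N \<ge> 1 \<Longrightarrow> B N \<subseteq> A"
    and "\<And>N. N \<ge> 1 \<Longrightarrow> finite (B N)"
    and "\<And>N. N \<ge> 1 \<Longrightarrow> card (B N) = N ^ l"
    and "\<And>N x. N \<ge> 1 \<Longrightarrow> x \<in> B N \<Longrightarrow> f x \<ge> D * real N powr (- b)"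
  shows "\<not> f summable_on A"
proof
  assume summable: "f summable_on A"
  obtain N :: nat where N: "N \<ge> 1" "D * real N powr (real l - b) > infsum f A"
    using not_bounded_powr[of D "real l - b" "infsum f A"] assms(2,3) by auto
  have "D * real N powr (real l - b) = real (card (B N)) * (D * real N powr (- b))"
    using N(1) assms(6)[OF N(1)]
    by (simp add: powr_diff powr_minus powr_realpow divide_inverse)
  also have "\<dots> \<le> sum f (B N)"
    using assms(7)[OF N(1)] by (intro sum_bounded_below) auto
  also have "\<dots> \<le> infsum f A"
    using summable assms(1) assms(4,5)[OF N(1)] by (intro finite_sum_le_infsum) auto
  finally show False using N(2) by simp
qed

lemma eval_poly_ge_eval_ones:
  assumes "\<And>i j. i \<in> factors P \<Longrightarrow> j \<in> vars P \<Longrightarrow> coeff P i j \<ge> 0"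
    and "\<And>j. j \<in> vars P \<Longrightarrow> x j \<ge> 1"
  shows "eval_poly P (\<lambda>_. 1) \<le> eval_poly P x"
  unfolding eval_poly_def
  using assms by (intro prod_mono conjI sum_nonneg sum_mono mult_left_mono) auto

lemma eval_poly_ones_pos:
  assumes "finite (vars P)"
    and "\<And>i j. i \<in> factors P \<Longrightarrow> j \<in> vars P \<Longrightarrow> coeff P i j \<ge> 0"
    and "\<And>i. i \<in> factors P \<Longrightarrow> \<exists>j\<in>vars P. coeff P i j > 0"
  shows "eval_poly P (\<lambda>_. 1) > 0"
  unfolding eval_poly_def
proof (rule prod_pos)
  fix i assume i: "i \<in> factors P"
  then obtain j where "j \<in> vars P" "coeff P i j > 0"
    using assms(3) by blast
  then show "(\<Sum>j\<in>vars P. coeff P i j * 1) > 0"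
    using assms(1,2) i by (intro sum_pos2[of _ j]) auto
qed

text \<open>
  The factors of the subpolynomial of \<open>J\<close> take the same value at \<open>x\<close> as at \<open>(1, \<dots>, 1)\<close>. Each other
  factor is a linear form with nonnegative coefficients, so it is at most its value at
  \<open>(N, \<dots>, N)\<close>, which is \<open>N\<close> times its value at \<open>(1, \<dots>, 1)\<close>.
\<close>

lemma eval_poly_le_on_box:
  assumes fin: "finite (factors P)"
    and nonneg: "\<And>i j. i \<in> factors P \<Longrightarrow> j \<in> vars P \<Longrightarrow> coeff P i j \<ge> 0"
    and "N \<ge> 1"
    and x: "\<And>j. j \<in> vars P \<Longrightarrow> 0 \<le> x j \<and> x j \<le> N"
    and J: "\<And>j. j \<in> vars P \<Longrightarrow> j \<in> J \<Longrightarrow> x j = 1"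
  shows "eval_poly P x
    \<le> eval_poly P (\<lambda>_. 1) * N ^ (num_factors P - num_factors (subpoly P J))"
proof -
  define K where "K = factors (subpoly P J)"
  have K: "K \<subseteq> factors P"
    by (auto simp: K_def subpoly_def)
  have "(\<Sum>j\<in>vars P. coeff P i j * x j)
      \<le> (\<Sum>j\<in>vars P. coeff P i j * 1) * (if i \<in> K then 1 else N)" if i: "i \<in> factors P" for i
  proof (cases "i \<in> K")
    case True
    then have "(\<Sum>j\<in>vars P. coeff P i j * x j) = (\<Sum>j\<in>vars P. coeff P i j * 1)"
      using J by (intro sum.cong) (auto simp: K_def subpoly_def)
    then show ?thesis using True by simp
  next
    case False
    have "(\<Sum>j\<in>vars P. coeff P i j * x j) \<le> (\<Sum>j\<in>vars P. coeff P i j * N)"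
      using nonneg i x by (intro sum_mono mult_left_mono) auto
    then show ?thesis using False by (simp add: sum_distrib_right)
  qed
  then have "eval_poly P x
      \<le> (\<Prod>i\<in>factors P. (\<Sum>j\<in>vars P. coeff P i j * 1) * (if i \<in> K then 1 else N))"
    unfolding eval_poly_def using nonneg x
    by (intro prod_mono) (auto intro!: sum_nonneg)
  also have "\<dots> = eval_poly P (\<lambda>_. 1) * (\<Prod>i\<in>factors P. if i \<in> K then 1 else N)"
    by (simp add: eval_poly_def prod.distrib)
  also have "(\<Prod>i\<in>factors P. if i \<in> K then 1 else N) = N ^ card (factors P - K)"
    using fin K by (simp add: prod.If_cases Int_absorb1 Diff_eq)
  also have "card (factors P - K) = num_factors P - num_factors (subpoly P J)"
    using fin K by (simp add: card_Diff_subset finite_subset num_factors_def K_def)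
  finally show ?thesis .
qed

lemma alpha_attained:
  assumes "finite (vars P)" "vars P \<noteq> {}"
  obtains J where "J \<subset> vars P"
    "alpha P = (real (num_vars P) - real (card J)) /
               (real (num_factors P) - real (num_factors (subpoly P J)))"
proof -
  let ?g = "\<lambda>Q. (real (num_vars P) - real (num_vars Q)) /
                (real (num_factors P) - real (num_factors Q))"
  have "proper_subpolys P = subpoly P ` {J. J \<subset> vars P}"
    by (auto simp: proper_subpolys_def)
  moreover have "finite {J. J \<subset> vars P}"
    by (rule finite_subset[of _ "Pow (vars P)"]) (use assms in auto)
  moreover have "{} \<in> {J. J \<subset> vars P}"
    using assms by auto
  ultimately have "finite (?g ` proper_subpolys P)" "?g ` proper_subpolys P \<noteq> {}"
    by auto
  then have "alpha P \<in> ?g ` proper_subpolys P"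
    unfolding alpha_def by (rule Max_in)
  then obtain J where "J \<subset> vars P" "alpha P = ?g (subpoly P J)"
    by (auto simp: proper_subpolys_def)
  then show thesis
    using that by (simp add: num_vars_def subpoly_def)
qed

text \<open>
  The denominators in the definition of \<open>\<alpha>\<close> are positive: a variable outside \<open>J\<close> occurs in some
  factor, which is then not a factor of the subpolynomial.
\<close>

lemma num_factors_subpoly_less:
  assumes "finite (factors P)" "J \<subset> vars P"
    and "\<And>j. j \<in> vars P \<Longrightarrow> \<exists>i\<in>factors P. coeff P i j \<noteq> 0"
  shows "num_factors (subpoly P J) < num_factors P"
proof -
  have "factors (subpoly P J) \<subset> factors P"
    using assms(2,3) by (fastforce simp: subpoly_def)
  then show ?thesis
    unfolding num_factors_def using assms(1) by (rule psubset_card_mono[rotated])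
qed

theorem theorem2p1:
  fixes r \<kappa> :: nat and a :: "nat \<Rightarrow> nat \<Rightarrow> real" and P :: linear_product and s :: real
  assumes "r \<ge> 1" and "\<kappa> \<ge> 1"
    and "P = Linear_Product {1..r} {1..\<kappa>} a"
    and "\<And>i j. i \<in> {1..\<kappa>} \<Longrightarrow> j \<in> {1..r} \<Longrightarrow> a i j \<ge> 0"
    and "\<And>i. i \<in> {1..\<kappa>} \<Longrightarrow> \<exists>j\<in>{1..r}. a i j > 0"
    and "\<And>j. j \<in> {1..r} \<Longrightarrow> \<exists>i\<in>{1..\<kappa>}. a i j \<noteq> 0"
    and "s < alpha P"
  shows "\<not> zeta_converges P s"
proof -
  have fin: "finite (vars P)" "finite (factors P)" and ne: "vars P \<noteq> {}"
    using assms(1,3) by auto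
  have nonneg: "coeff P i j \<ge> 0" if "i \<in> factors P" "j \<in> vars P" for i j
    using assms(3,4) that by auto
  have pos: "\<exists>j\<in>vars P. coeff P i j > 0" if "i \<in> factors P" for i
    using assms(3,5) that by auto
  have occurs: "\<exists>i\<in>factors P. coeff P i j \<noteq> 0" if "j \<in> vars P" for j
    using assms(3,6) that by auto
  obtain J where J: "J \<subset> vars P" and alpha: "alpha P = (real (num_vars P) - real (card J)) /
      (real (num_factors P) - real (num_factors (subpoly P J)))"
    using alpha_attained[OF fin(1) ne] .
  define l where "l = card (vars P - J)"
  define m where "m = num_factors P - num_factors (subpoly P J)"
  define t where "t = max s 0"
  define C where "C = eval_poly P (\<lambda>_. 1)"
  define B where "B N = (\<Pi>\<^sub>E j\<in>vars P. if j \<in> J then {1} else {1..N})" for N :: nat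
  have "finite J" using J fin by (meson finite_subset psubset_imp_subset)
  have "l > 0" using J fin(1) by (auto simp: l_def card_gt_0_iff)
  have "m > 0" using num_factors_subpoly_less[OF fin(2) J occurs] by (simp add: m_def)
  have "alpha P = real l / real m"
    using alpha J \<open>finite J\<close> fin(1) num_factors_subpoly_less[OF fin(2) J occurs]
    by (simp add: l_def m_def num_vars_def card_Diff_subset of_nat_diff card_mono psubset_imp_subset)
  then have "t < real l / real m"
    using \<open>s < alpha P\<close> \<open>l > 0\<close> \<open>m > 0\<close> by (simp add: t_def)
  then have mt: "real m * t < real l"
    using \<open>m > 0\<close> by (simp add: field_simps)
  have "C > 0"
    unfolding C_def using fin(1) nonneg pos by (rule eval_poly_ones_pos)
  show ?thesis
    unfolding zeta_converges_def
  proof (rule not_summable_on_boxes[where B = B and D = "C powr (- s)", OF _ _ mt])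
    show "C powr (- s) > 0" using \<open>C > 0\<close> by simp
  next
    fix N :: nat assume N: "N \<ge> 1"
    show "B N \<subseteq> vars P \<rightarrow>\<^sub>E {1..}"
      unfolding B_def by (rule PiE_mono) auto
    show "finite (B N)"
      unfolding B_def using fin(1) by (intro finite_PiE) auto
    have "card (B N) = (\<Prod>j\<in>vars P. if j \<in> J then 1 else N)"
      unfolding B_def using fin(1) by (subst card_PiE) (auto intro!: prod.cong)
    also have "\<dots> = N ^ l"
      using fin(1) by (simp add: prod.If_cases l_def Diff_eq)
    finally show "card (B N) = N ^ l" .
    fix x assume x: "x \<in> B N"
    have range: "x j \<in> (if j \<in> J then {1} else {1..N})" if "j \<in> vars P" for j
      using x that unfolding B_def by (rule PiE_mem)
    define y where "y = (\<lambda>j. real (x j))"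
    have y: "1 \<le> y j \<and> y j \<le> real N" "j \<in> J \<Longrightarrow> y j = 1" if "j \<in> vars P" for j
      using range[OF that] N by (auto simp: y_def split: if_splits)
    have lower: "C \<le> eval_poly P y"
      unfolding C_def using nonneg y by (intro eval_poly_ge_eval_ones) auto
    have upper: "eval_poly P y \<le> C * real N ^ m"
      unfolding C_def m_def using fin(2) nonneg N y
      by (intro eval_poly_le_on_box) (auto intro: order_trans[OF zero_le_one])
    have "C powr (- s) * real N powr (- (real m * t)) \<le> eval_poly P y powr (- s)"
    proof (cases "s \<ge> 0")
      case True
      have "(C * real N ^ m) powr (- s) \<le> eval_poly P y powr (- s)"
        using True lower upper \<open>C > 0\<close> by (intro powr_mono2') auto
      also have "(C * real N ^ m) powr (- s) = C powr (- s) * real N powr (- (real m * t))"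
        using True \<open>C > 0\<close> N by (simp add: powr_mult powr_powr t_def flip: powr_realpow)
      finally show ?thesis .
    next
      case False
      then have "C powr (- s) \<le> eval_poly P y powr (- s)"
        using lower \<open>C > 0\<close> by (intro powr_mono2) auto
      then show ?thesis using False N by (simp add: t_def)
    qed
    then show "eval_poly P (\<lambda>j. real (x j)) powr (- s)
        \<ge> C powr (- s) * real N powr (- (real m * t))"
      by (simp add: y_def)
  qed auto
qed

end
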